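(* Any finite family $\vec{\mathcal H}$ of finite acyclic digraphs has finite isometric Ramsey number $\mathrm{IR}(\vec{\mathcal H})$.
   Context: Graphs are simple and undirected. A digraph $\vec G=(V_{\vec G},E_{\vec G})$ has $E_{\vec G}\subset V_{\vec G}\times V_{\vec G}$ with neither loops nor pairs of opposite arcs. It is acyclic if it contains no directed cycles. An orientation $\vec G$ of a graph $G$ is a digraph on $V_G$ obtained by replacing each edge $\{a,b\}$ by exactly one of $(a,b)$, $(b,a)$. The distance $d_G(u,v)$ is the smallest number of edges of a path in $G$ joining $u$ and $v$ ($\infty$ if there is none); distance in a digraph is the distance in its underlying undirected graph. For a graph $G$ and a digraph $\vec H$, $G\Rightarrow\vec H$ means: for every orientation $\vec G$ of $G$ there is an injective map $f:V_{\vec H}\to V_G$ such that (i) for all $u,v\in V_{\vec H}$, $(u,v)\in E_{\vec H}$ if and only if $(f(u),f(v))\in E_{\vec G}$, and (ii) $d_{\vec H}(u,v)=d_G(f(u),f(v))$ for all $u,v\in V_{\vec H}$. For a class $\vec{\mathcal H}$ of digraphs, $G\Rightarrow\vec{\mathcal H}$ means $G\Rightarrow\vec H$ for every $\vec H\in\vec{\mathcal H}$, and $\mathrm{IR}(\vec{\mathcal H})$ is the smallest number of vertices of a graph $G$ with $G\Rightarrow\vec{\mathcal H}$ ($\infty$ if no such graph exists; finiteness of $\mathrm{IR}(\vec{\mathcal H})$ means that some finite graph $G$ satisfies $G\Rightarrow\vec{\mathcal H}$). *)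

theory Defs
  imports "Graph_Theory.Graph_Theory" "HOL-Library.Extended_Nat"
begin

text \<open>
  Following \<^theory>\<open>Graph_Theory.Graph_Theory\<close>, an undirected simple graph is a symmetric loop-free
  digraph: the edge \<open>{a, b}\<close> is represented by the two arcs \<open>(a, b)\<close> and \<open>(b, a)\<close>. Both
  \<^const>\<open>pair_graph\<close> and \<^const>\<open>pair_digraph\<close> include finiteness; \<^const>\<open>pair_digraph\<close> excludes loops
  but not pairs of opposite arcs.
\<close>

definition oriented_digraph :: "'a pair_pre_digraph \<Rightarrow> bool" where
  "oriented_digraph H \<longleftrightarrow>
     pair_digraph H \<and> (\<forall>u v. (u, v) \<in> parcs H \<longrightarrow> (v, u) \<notin> parcs H)"

definition acyclic_digraph :: "'a pair_pre_digraph \<Rightarrow> bool" where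
  "acyclic_digraph H \<longleftrightarrow> \<not> (\<exists>c. pre_digraph.cycle (with_proj H) c)"

definition orientation :: "'a pair_pre_digraph \<Rightarrow> 'a pair_pre_digraph \<Rightarrow> bool" where
  "orientation D G \<longleftrightarrow>
     pverts D = pverts G \<and> parcs D \<subseteq> parcs G \<and>
     (\<forall>(a, b) \<in> parcs G. (a, b) \<in> parcs D \<longleftrightarrow> (b, a) \<notin> parcs D)"

text \<open>
  Distance in the underlying undirected graph. For a symmetric \<open>G\<close>, \<^term>\<open>mk_symmetric (with_proj G)\<close>
  is \<open>G\<close> itself, so the same function serves graphs and digraphs. In \<^typ>\<open>enat\<close> the infimum of the
  empty set is \<open>\<infinity>\<close>.
\<close>

definition graph_dist :: "'a pair_pre_digraph \<Rightarrow> 'a \<Rightarrow> 'a \<Rightarrow> enat" where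
  "graph_dist G u v =
     (INF p \<in> {p. pre_digraph.apath (with_proj (mk_symmetric (with_proj G))) u p v}.
        enat (length p))"

text \<open>
  In the second condition distances in the target are taken in the graph \<open>G\<close>.
\<close>

definition isometric_copy ::
  "('b \<Rightarrow> 'a) \<Rightarrow> 'b pair_pre_digraph \<Rightarrow> 'a pair_pre_digraph \<Rightarrow> 'a pair_pre_digraph \<Rightarrow> bool" where
  "isometric_copy f H D G \<longleftrightarrow>
     inj_on f (pverts H) \<and> f ` pverts H \<subseteq> pverts G \<and>
     (\<forall>u \<in> pverts H. \<forall>v \<in> pverts H. (u, v) \<in> parcs H \<longleftrightarrow> (f u, f v) \<in> parcs D) \<and>
     (\<forall>u \<in> pverts H. \<forall>v \<in> pverts H. graph_dist H u v = graph_dist G (f u) (f v))"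

definition isometric_arrow :: "'a pair_pre_digraph \<Rightarrow> 'b pair_pre_digraph \<Rightarrow> bool" where
  "isometric_arrow G H \<longleftrightarrow> (\<forall>D. orientation D G \<longrightarrow> (\<exists>f. isometric_copy f H D G))"

text \<open>
  Every finite graph is isomorphic to one with vertices in \<^typ>\<open>nat\<close>, and infinite host graphs would
  only contribute the value \<open>\<infinity>\<close>; so it suffices to let \<open>G\<close> range over finite graphs on \<^typ>\<open>nat\<close>.
\<close>

definition IR :: "'a pair_pre_digraph set \<Rightarrow> enat" where
  "IR Hs = (INF G \<in> {G :: nat pair_pre_digraph. pair_graph G \<and> (\<forall>H \<in> Hs. isometric_arrow G H)}.
     enat (card (pverts G)))"

end

theory Submission
  imports Defs "HOL-Library.Countable" "HOL-Library.FuncSet"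
begin

text \<open>
  By induction on \<open>m\<close> one finds finite graphs, each with a finite set of maps of \<open>H\<close> into it, such
  that every orientation is respected by one of the maps and no walk of length at most \<open>m\<close> between
  two vertices of a copy is shorter than the distance in \<open>H\<close>. For \<open>m = 0\<close> a large complete graph
  works, since each tournament on \<open>2 ^ n\<close> vertices contains a transitive tournament on \<open>n\<close> vertices
  and \<open>H\<close> has a topological order. The step from \<open>W\<close> to \<open>m + 1\<close> is a partite construction over
  \<open>W\<close>: start with disjoint copies of \<open>H\<close> projecting to the copies in \<open>W\<close>, and for each edge
  \<open>{i, j}\<close> of \<open>W\<close> amalgamate many copies of the current system along a Hales-Jewett cube over that
  edge, so that in some copy all arcs over \<open>{i, j}\<close> point the same way. A walk of length \<open>m + 1\<close>
  either projects to a walk of \<open>W\<close> that can be shortened, where \<open>W\<close> already controls distances,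
  or projects to a geodesic, and then it stays inside one of the amalgamated copies.
  Infinite distances are finally realised by disjoint copies, one for each component of \<open>H\<close>.
\<close>

section \<open>The Hales-Jewett theorem\<close>

text \<open>A combinatorial line of a cube is coded as a word over the alphabet extended by
  \<open>None\<close>, which marks the active coordinates. \<open>fill z w\<close> is the point of
  the line \<open>w\<close> at the letter \<open>z\<close>. A genuine line has \<open>None\<close>
  in \<open>set w\<close>.\<close>

definition fill :: "'a \<Rightarrow> 'a option list \<Rightarrow> 'a list" where
  "fill z w = map (case_option z id) w"

lemma length_fill [simp]: "length (fill z w) = length w"
  by (simp add: fill_def)

lemma set_fill: "z \<in> B \<Longrightarrow> set w \<subseteq> insert None (Some ` B) \<Longrightarrow> set (fill z w) \<subseteq> B"
  by (fastforce simp: fill_def split: option.splits)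

lemma fill_None_inj: "None \<in> set w \<Longrightarrow> fill x w = fill y w \<Longrightarrow> x = y"
  by (induction w) (auto simp: fill_def)

text \<open>At an active coordinate of \<open>w\<close> the two equations read off \<open>u\<close>
  and \<open>v\<close>. There \<open>w'\<close> has either \<open>None\<close>, which gives
  \<open>(u', v')\<close>, or a letter of \<open>X\<close>, which is then \<open>(u, v)\<close>
  itself. This controls how copies indexed by two lines can overlap.\<close>

lemma fill_pair_mem:
  assumes "length w = length w'" "None \<in> set w" "set w' \<subseteq> insert None (Some ` X)"
    and "fill u (map (map_option fst) w) = fill u' (map (map_option fst) w')"
    and "fill v (map (map_option snd) w) = fill v' (map (map_option snd) w')"
  shows "(u, v) \<in> insert (u', v') X"
  using assms
  by (induction w w' rule: list_induct2) (auto simp: fill_def split: option.splits)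

lemma map_fst_fill: "map fst (fill p w) = fill (fst p) (map (map_option fst) w)"
  and map_snd_fill: "map snd (fill p w) = fill (snd p) (map (map_option snd) w)"
  by (auto simp: fill_def split: option.split)

lemma hd_fill_mem: "w \<noteq> [] \<Longrightarrow> set w \<subseteq> insert None (Some ` Y) \<Longrightarrow> hd (fill x w) \<in> insert x Y"
  by (cases w) (auto simp: fill_def split: option.split)

lemma set_concat_fill:
  assumes "set x \<subseteq> B" "\<forall>w \<in> set ws. set w \<subseteq> insert None (Some ` B)"
  shows "set (concat (map2 fill x ws)) \<subseteq> B"
proof -
  have "set (fill z v) \<subseteq> B" if "(z, v) \<in> set (zip x ws)" for z v
    using that assms by (intro set_fill) (auto dest: set_zip_leftD set_zip_rightD)
  then show ?thesis by fastforce
qed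

lemma length_concat_fill:
  assumes "length x = length ws"
  shows "length (concat (map2 fill x ws)) = length (concat ws)"
  using assms by (induction x ws rule: list_induct2) simp_all

text \<open>The words made of \<open>i\<close> letters \<open>a\<close> followed by letters
  \<open>b\<close> number one more than the colours, so two of them agree in colour.\<close>

lemma fill_pigeonhole:
  fixes a b :: 'a and C :: "nat set"
  assumes "finite C"
  shows "\<exists>n. \<forall>c. (\<forall>x. set x \<subseteq> {a, b} \<and> length x = n \<longrightarrow> c x \<in> C) \<longrightarrow>
    (\<exists>w. length w = n \<and> None \<in> set w \<and> set w \<subseteq> {None, Some a, Some b} \<and> c (fill a w) = c (fill b w))"
proof (rule exI[of _ "card C"], intro allI impI)
  let ?n = "card C"
  fix c :: "'a list \<Rightarrow> nat"
  assume c: "\<forall>x. set x \<subseteq> {a, b} \<and> length x = ?n \<longrightarrow> c x \<in> C"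
  define p where "p i = replicate i a @ replicate (?n - i) b" for i
  have "(\<lambda>i. c (p i)) ` {..?n} \<subseteq> C"
  proof (rule image_subsetI)
    fix i assume "i \<in> {..?n}"
    then have "set (p i) \<subseteq> {a, b} \<and> length (p i) = ?n" by (auto simp: p_def)
    then show "c (p i) \<in> C" using c by blast
  qed
  then have "card ((\<lambda>i. c (p i)) ` {..?n}) < card {..?n}"
    using card_mono[OF assms] by (metis card_atMost le_imp_less_Suc)
  then have "\<not> inj_on (\<lambda>i. c (p i)) {..?n}"
    by (rule pigeonhole)
  then obtain i j where ij: "i < j" "j \<le> ?n" "c (p i) = c (p j)"
    unfolding inj_on_def by (metis atMost_iff linorder_neqE_nat)
  \<comment> \<open>The positions where \<open>p i\<close> and \<open>p j\<close> differ become
    active, so filling with \<open>a\<close> gives \<open>p j\<close> and filling with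
    \<open>b\<close> gives \<open>p i\<close>.\<close>
  let ?w = "replicate i (Some a) @ replicate (j - i) None @ replicate (?n - j) (Some b)"
  have "fill a ?w = replicate (i + (j - i)) a @ replicate (?n - j) b"
    by (simp add: fill_def replicate_add)
  moreover have "fill b ?w = replicate i a @ replicate ((j - i) + (?n - j)) b"
    by (simp add: fill_def replicate_add)
  ultimately have "fill a ?w = p j" "fill b ?w = p i"
    using ij by (simp_all add: p_def)
  then show "\<exists>w. length w = ?n \<and> None \<in> set w \<and> set w \<subseteq> {None, Some a, Some b} \<and>
      c (fill a w) = c (fill b w)"
    using ij by (intro exI[of _ ?w]) auto
qed

text \<open>Shelah's trick: words made of \<open>m\<close> blocks whose colour does not change when letters \<open>b\<close> are
  replaced by \<open>a\<close>, so that only the smaller alphabet without \<open>b\<close> remains to be treated.\<close>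

lemma fill_insensitive_blocks:
  fixes B :: "'a set" and C :: "nat set"
  assumes B: "finite B" "a \<in> B" "b \<in> B" and C: "finite C"
  defines "\<sigma> \<equiv> \<lambda>z. if z = b then a else z"
  shows "\<exists>N. \<forall>c. (\<forall>x. set x \<subseteq> B \<and> length x = N \<longrightarrow> c x \<in> C) \<longrightarrow>
    (\<exists>ws. length ws = m \<and> length (concat ws) = N \<and>
      (\<forall>w \<in> set ws. None \<in> set w \<and> set w \<subseteq> insert None (Some ` B)) \<and>
      (\<forall>x. set x \<subseteq> B \<and> length x = m \<longrightarrow>
        c (concat (map2 fill x ws)) = c (concat (map2 fill (map \<sigma> x) ws))))"
  using C
proof (induction m arbitrary: C)
  case 0
  show ?case by (intro exI[of _ 0]) auto
next
  case (Suc m)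
  obtain zs where zs: "set zs = B" using finite_list[OF B(1)] by blast
  \<comment> \<open>A tail \<open>x\<close> of length \<open>N\<close> will be coloured by the list
    of colours of \<open>fill z w @ x\<close> over all letters \<open>z\<close>, packed into one
    number. These colours depend only on \<open>C\<close> and the number of letters, so
    \<open>N\<close> can be fixed before \<open>w\<close> is known.\<close>
  define C1 where "C1 = list_encode ` {l. set l \<subseteq> C \<and> length l = length zs}"
  have "finite C1" unfolding C1_def using Suc.prems by (simp add: finite_lists_length_eq)
  from Suc.IH[OF this] obtain N where N: "\<And>c. (\<forall>x. set x \<subseteq> B \<and> length x = N \<longrightarrow> c x \<in> C1) \<Longrightarrow>
    (\<exists>ws. length ws = m \<and> length (concat ws) = N \<and>
      (\<forall>w \<in> set ws. None \<in> set w \<and> set w \<subseteq> insert None (Some ` B)) \<and>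
      (\<forall>x. set x \<subseteq> B \<and> length x = m \<longrightarrow>
        c (concat (map2 fill x ws)) = c (concat (map2 fill (map \<sigma> x) ws))))"
    by blast
  obtain xs where xs: "set xs = {x. set x \<subseteq> B \<and> length x = N}"
    using finite_list[OF finite_lists_length_eq[OF B(1)]] by metis
  \<comment> \<open>A first block is coloured by the colours of all its continuations of length
    \<open>N\<close>, so its length \<open>n\<close> is chosen after \<open>N\<close>. Two blocks of
    equal colour are then interchangeable before every continuation.\<close>
  define C2 where "C2 = list_encode ` {l. set l \<subseteq> C \<and> length l = length xs}"
  have "finite C2" unfolding C2_def using Suc.prems by (simp add: finite_lists_length_eq)
  from fill_pigeonhole[OF this, of a b] obtain n where
    n: "\<And>c. (\<forall>x. set x \<subseteq> {a, b} \<and> length x = n \<longrightarrow> c x \<in> C2) \<Longrightarrow>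
    (\<exists>w. length w = n \<and> None \<in> set w \<and> set w \<subseteq> {None, Some a, Some b} \<and> c (fill a w) = c (fill b w))"
    by blast
  show ?case
  proof (intro exI[of _ "n + N"] allI impI)
    fix c :: "'a list \<Rightarrow> nat"
    assume c: "\<forall>x. set x \<subseteq> B \<and> length x = n + N \<longrightarrow> c x \<in> C"
    have "\<forall>y. set y \<subseteq> {a, b} \<and> length y = n \<longrightarrow> list_encode (map (\<lambda>x. c (y @ x)) xs) \<in> C2"
    proof (intro allI impI)
      fix y assume y: "set y \<subseteq> {a, b} \<and> length y = n"
      have "c (y @ x) \<in> C" if "x \<in> set xs" for x
      proof -
        have "set (y @ x) \<subseteq> B" "length (y @ x) = n + N" using that xs y B by auto
        then show ?thesis using c by blast
      qed
      then show "list_encode (map (\<lambda>x. c (y @ x)) xs) \<in> C2"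
        unfolding C2_def by (intro imageI) auto
    qed
    from n[OF this] obtain w where w: "length w = n" "None \<in> set w" "set w \<subseteq> {None, Some a, Some b}"
      and enc: "list_encode (map (\<lambda>x. c (fill a w @ x)) xs) = list_encode (map (\<lambda>x. c (fill b w @ x)) xs)"
      by blast
    have wab: "c (fill a w @ x) = c (fill b w @ x)" if "set x \<subseteq> B" "length x = N" for x
    proof -
      have "x \<in> set xs" using that xs by blast
      then show ?thesis using enc unfolding list_encode_eq map_eq_conv by blast
    qed
    have wB: "set w \<subseteq> insert None (Some ` B)" using w B by auto
    have "\<forall>x. set x \<subseteq> B \<and> length x = N \<longrightarrow> list_encode (map (\<lambda>z. c (fill z w @ x)) zs) \<in> C1"
    proof (intro allI impI)
      fix x assume x: "set x \<subseteq> B \<and> length x = N"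
      have "c (fill z w @ x) \<in> C" if "z \<in> B" for z
        using c x w(1) set_fill[OF that wB] by (metis le_sup_iff length_append length_fill set_append)
      then show "list_encode (map (\<lambda>z. c (fill z w @ x)) zs) \<in> C1"
        unfolding C1_def using zs by (intro imageI) auto
    qed
    from N[OF this] obtain ws where ws: "length ws = m" "length (concat ws) = N"
      "\<forall>w \<in> set ws. None \<in> set w \<and> set w \<subseteq> insert None (Some ` B)"
      and eq: "\<And>x. set x \<subseteq> B \<Longrightarrow> length x = m \<Longrightarrow>
        list_encode (map (\<lambda>z. c (fill z w @ concat (map2 fill x ws))) zs) =
        list_encode (map (\<lambda>z. c (fill z w @ concat (map2 fill (map \<sigma> x) ws))) zs)"
      by blast
    have len: "set (concat (map2 fill x ws)) \<subseteq> B \<and> length (concat (map2 fill x ws)) = N"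
      if "set x \<subseteq> B" "length x = m" for x
      using set_concat_fill[of x B ws] length_concat_fill[of x ws] that ws by metis
    have "c (concat (map2 fill x (w # ws))) = c (concat (map2 fill (map \<sigma> x) (w # ws)))"
      if x: "set x \<subseteq> B" "length x = Suc m" for x
    proof -
      obtain z y where xy: "x = z # y" using x(2) by (cases x) auto
      have y: "set y \<subseteq> B" "length y = m" and z: "z \<in> B" using x xy by auto
      have y': "set (map \<sigma> y) \<subseteq> B" "length (map \<sigma> y) = m"
        using y B by (auto simp: \<sigma>_def)
      \<comment> \<open>First the letters \<open>b\<close> in the later blocks are replaced by the
        induction hypothesis, then the one filling the first block by \<open>wab\<close>.\<close>
      have "c (fill z w @ concat (map2 fill y ws)) = c (fill z w @ concat (map2 fill (map \<sigma> y) ws))"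
        using eq[OF y] z zs unfolding list_encode_eq map_eq_conv by blast
      also have "\<dots> = c (fill (\<sigma> z) w @ concat (map2 fill (map \<sigma> y) ws))"
        using wab len[OF y'] by (auto simp: \<sigma>_def)
      finally show ?thesis by (simp add: xy)
    qed
    moreover have "length (w # ws) = Suc m" "length (concat (w # ws)) = n + N"
      "\<forall>w' \<in> set (w # ws). None \<in> set w' \<and> set w' \<subseteq> insert None (Some ` B)"
      using w wB ws by auto
    ultimately show "\<exists>ws. length ws = Suc m \<and> length (concat ws) = n + N \<and>
      (\<forall>w \<in> set ws. None \<in> set w \<and> set w \<subseteq> insert None (Some ` B)) \<and>
      (\<forall>x. set x \<subseteq> B \<and> length x = Suc m \<longrightarrow>
        c (concat (map2 fill x ws)) = c (concat (map2 fill (map \<sigma> x) ws)))"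
      by blast
  qed
qed

text \<open>A line \<open>u\<close> in the space of blocks is itself a line in the full cube: an
  inactive coordinate fixes its whole block, an active one leaves the variables of the block in
  place.\<close>

lemma fill_compose:
  assumes "length u = length ws"
  shows "fill z (concat (map2 (\<lambda>p w. case_option w (\<lambda>a. map Some (fill a w)) p) u ws)) =
    concat (map2 fill (fill z u) ws)"
  using assms
  by (induction u ws rule: list_induct2) (auto simp: fill_def split: option.split)

text \<open>Induction on the alphabet. Insensitive blocks turn a colouring over
  \<open>insert b A\<close> into one of words over \<open>A\<close>; a monochromatic line found
  there is composed with the blocks, and the letter \<open>b\<close> receives the colour of
  \<open>a\<close>.\<close>

theorem hales_jewett:
  fixes A :: "'a set" and C :: "nat set"
  assumes "finite A" and C: "finite C"
  shows "\<exists>N. \<forall>c. (\<forall>x. set x \<subseteq> A \<and> length x = N \<longrightarrow> c x \<in> C) \<longrightarrow>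
    (\<exists>w k. length w = N \<and> None \<in> set w \<and> set w \<subseteq> insert None (Some ` A) \<and>
      (\<forall>z \<in> A. c (fill z w) = k))"
  using assms(1)
proof (induction A rule: finite_induct)
  case empty
  show ?case by (intro exI[of _ 1] allI impI exI[of _ "[None]"]) auto
next
  case (insert b A)
  show ?case
  proof (cases "A = {}")
    case True
    have "\<exists>w k. length w = 1 \<and> None \<in> set w \<and> set w \<subseteq> insert None (Some ` insert b A) \<and>
        (\<forall>z \<in> insert b A. c (fill z w) = k)" for c :: "'a list \<Rightarrow> nat"
      by (intro exI[of _ "[None]"] exI[of _ "c (fill b [None])"]) (simp add: True)
    then show ?thesis by blast
  next
    case False
    then obtain a where a: "a \<in> A" by blast
    let ?B = "insert b A"
    let ?\<sigma> = "\<lambda>z. if z = b then a else z"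
    obtain m where m: "\<And>c. (\<forall>x. set x \<subseteq> A \<and> length x = m \<longrightarrow> c x \<in> C) \<Longrightarrow>
      (\<exists>w k. length w = m \<and> None \<in> set w \<and> set w \<subseteq> insert None (Some ` A) \<and>
        (\<forall>z \<in> A. c (fill z w) = k))"
      using insert.IH by blast
    have "finite ?B" "a \<in> ?B" "b \<in> ?B" using insert.hyps a by auto
    from fill_insensitive_blocks[OF this C, of m] obtain N where
      N: "\<And>c. (\<forall>x. set x \<subseteq> ?B \<and> length x = N \<longrightarrow> c x \<in> C) \<Longrightarrow>
    (\<exists>ws. length ws = m \<and> length (concat ws) = N \<and>
      (\<forall>w \<in> set ws. None \<in> set w \<and> set w \<subseteq> insert None (Some ` ?B)) \<and>
      (\<forall>x. set x \<subseteq> ?B \<and> length x = m \<longrightarrow>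
        c (concat (map2 fill x ws)) = c (concat (map2 fill (map ?\<sigma> x) ws))))"
      by blast
    show ?thesis
    proof (intro exI[of _ N] allI impI)
      fix c :: "'a list \<Rightarrow> nat"
      assume c: "\<forall>x. set x \<subseteq> ?B \<and> length x = N \<longrightarrow> c x \<in> C"
      from N[OF this] obtain ws where ws: "length ws = m" "length (concat ws) = N"
        "\<forall>w \<in> set ws. None \<in> set w \<and> set w \<subseteq> insert None (Some ` ?B)"
        and eq: "\<And>x. set x \<subseteq> ?B \<Longrightarrow> length x = m \<Longrightarrow>
          c (concat (map2 fill x ws)) = c (concat (map2 fill (map ?\<sigma> x) ws))"
        by blast
      have len: "set (concat (map2 fill x ws)) \<subseteq> ?B \<and> length (concat (map2 fill x ws)) = N"
        if "set x \<subseteq> ?B" "length x = m" for x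
        using set_concat_fill[of x ?B ws] length_concat_fill[of x ws] that ws by metis
      have "\<forall>x. set x \<subseteq> A \<and> length x = m \<longrightarrow> c (concat (map2 fill x ws)) \<in> C"
        using c len by blast
      from m[OF this] obtain u k where u: "length u = m" "None \<in> set u"
        "set u \<subseteq> insert None (Some ` A)"
        and k: "\<And>z. z \<in> A \<Longrightarrow> c (concat (map2 fill (fill z u) ws)) = k"
        by blast
      let ?v = "concat (map2 (\<lambda>p w. case_option w (\<lambda>a. map Some (fill a w)) p) u ws)"
      have fillv: "fill z ?v = concat (map2 fill (fill z u) ws)" for z
        using u(1) ws(1) by (intro fill_compose) simp
      \<comment> \<open>The fixed letters of \<open>u\<close> lie in \<open>A\<close>, so
        \<open>b\<close> occurs in \<open>fill b u\<close> only at active coordinates.\<close>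
      have "map ?\<sigma> (fill b u) = fill a u"
        using u(3) insert.hyps(2) by (auto simp: fill_def split: option.split)
      moreover have "set (fill b u) \<subseteq> ?B"
        using u(3) by (intro set_fill) auto
      ultimately have "c (fill b ?v) = c (concat (map2 fill (fill a u) ws))"
        unfolding fillv using eq[of "fill b u"] u(1) by (metis length_fill)
      then have "\<forall>z \<in> ?B. c (fill z ?v) = k"
        using k a unfolding fillv by blast
      moreover have "length (fill b ?v) = N"
        unfolding fillv using len[of "fill b u"] u(1) \<open>set (fill b u) \<subseteq> ?B\<close> by simp
      then have "length ?v = N" unfolding length_fill .
      moreover have "None \<in> set ?v"
      proof -
        obtain i where i: "i < m" "u ! i = None" using u by (metis in_set_conv_nth)
        have "(None, ws ! i) \<in> set (zip u ws)"
          unfolding in_set_zip using i u(1) ws(1) by (intro exI[of _ i]) simp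
        moreover have "None \<in> set (ws ! i)"
          using i(1) ws(1,3) nth_mem by blast
        ultimately show ?thesis
          unfolding set_concat set_map by (intro UN_I[OF imageI]) auto
      qed
      moreover have "set ?v \<subseteq> insert None (Some ` ?B)"
      proof
        fix p assume "p \<in> set ?v"
        then obtain q w where qw: "(q, w) \<in> set (zip u ws)"
          "p \<in> set (case_option w (\<lambda>a. map Some (fill a w)) q)"
          by auto
        then have "q \<in> set u" "w \<in> set ws" by (auto dest: set_zip_leftD set_zip_rightD)
        then have q: "q \<in> insert None (Some ` ?B)" and w: "set w \<subseteq> insert None (Some ` ?B)"
          using u(3) ws(3) by auto
        show "p \<in> insert None (Some ` ?B)"
        proof (cases q)
          case None
          then show ?thesis using qw w by auto
        next
          case (Some d)
          then have "d \<in> ?B" using q by auto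
          from set_fill[OF this w] show ?thesis using qw Some by auto
        qed
      qed
      ultimately show "\<exists>w k. length w = N \<and> None \<in> set w \<and> set w \<subseteq> insert None (Some ` ?B) \<and>
          (\<forall>z \<in> ?B. c (fill z w) = k)"
        by blast
    qed
  qed
qed

section \<open>Partite construction\<close>

lemma sym_relpow:
  assumes "sym R" "(x, y) \<in> R ^^ n"
  shows "(y, x) \<in> R ^^ n"
  using assms(2)
proof (induction n arbitrary: y)
  case (Suc n)
  then obtain z where "(x, z) \<in> R ^^ n" "(z, y) \<in> R" by auto
  then show ?case using Suc.IH symD[OF assms(1)] by (meson relpow_Suc_I2)
qed simp

lemma relpow_trans: "(x, y) \<in> R ^^ m \<Longrightarrow> (y, z) \<in> R ^^ n \<Longrightarrow> (x, z) \<in> R ^^ (m + n)"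
  by (auto simp: relpow_add)

lemma relpow_map:
  assumes "\<And>x y. (x, y) \<in> R \<Longrightarrow> (f x, f y) \<in> Q" "(x, y) \<in> R ^^ n"
  shows "(f x, f y) \<in> Q ^^ n"
  using assms(2)
proof (induction n arbitrary: y)
  case (Suc n)
  then obtain z where "(x, z) \<in> R ^^ n" "(z, y) \<in> R" by auto
  then show ?case using Suc.IH assms(1) by (meson relpow_Suc_I)
qed simp

text \<open>The properties of the gluing that the distance argument uses, free of words and cubes:
  by \<open>outside\<close> distinct copies meet only over \<open>i\<close> and \<open>j\<close>,
  and by \<open>induced\<close> the gluing creates no new arc between vertices of one copy.\<close>

locale amalgam =
  fixes W :: "'w rel" and i j :: 'w and A :: "'v rel" and \<pi> :: "'v \<Rightarrow> 'w"
    and Ls :: "'l set" and \<phi> :: "'l \<Rightarrow> 'v \<Rightarrow> 'p" and \<pi>' :: "'p \<Rightarrow> 'w"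
  assumes sym_W: "sym W" and ij: "(i, j) \<in> W"
    and sym_A: "sym A" and hom: "\<And>x y. (x, y) \<in> A \<Longrightarrow> (\<pi> x, \<pi> y) \<in> W"
    and inj: "\<And>L. L \<in> Ls \<Longrightarrow> inj (\<phi> L)"
    and proj: "\<And>L x. L \<in> Ls \<Longrightarrow> \<pi>' (\<phi> L x) = \<pi> x"
    and outside: "\<And>L L' x y. L \<in> Ls \<Longrightarrow> L' \<in> Ls \<Longrightarrow> \<phi> L x = \<phi> L' y \<Longrightarrow> \<pi> x \<notin> {i, j} \<Longrightarrow> L = L'"
    and induced: "\<And>L L' u v u' v'. L \<in> Ls \<Longrightarrow> L' \<in> Ls \<Longrightarrow> (u', v') \<in> A \<Longrightarrow>
      \<phi> L u = \<phi> L' u' \<Longrightarrow> \<phi> L v = \<phi> L' v' \<Longrightarrow> (u, v) \<in> A"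
begin

definition arcs :: "'p rel" where
  "arcs = {(\<phi> L x, \<phi> L y) | L x y. L \<in> Ls \<and> (x, y) \<in> A}"

lemma arcs_iff: "L \<in> Ls \<Longrightarrow> (\<phi> L u, \<phi> L v) \<in> arcs \<longleftrightarrow> (u, v) \<in> A"
  unfolding arcs_def using induced by blast

lemma sym_arcs: "sym arcs"
  unfolding arcs_def sym_def using symD[OF sym_A] by blast

lemma arcs_proj: "(p, q) \<in> arcs \<Longrightarrow> (\<pi>' p, \<pi>' q) \<in> W"
  unfolding arcs_def using proj hom by auto

text \<open>A vertex not over \<open>i\<close> or \<open>j\<close> lies in a single copy, so every
  arc at it belongs to that copy. The walk can change copies only at a vertex over \<open>i\<close>
  or \<open>j\<close>; the proof takes the first such vertex as \<open>z\<close>.\<close>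

lemma first_visit:
  assumes "L \<in> Ls" "(\<phi> L a, p) \<in> arcs ^^ l"
  shows "(\<exists>q. p = \<phi> L q \<and> (a, q) \<in> A ^^ l) \<or>
    (\<exists>s t z. s + t = l \<and> (a, z) \<in> A ^^ s \<and> \<pi> z \<in> {i, j} \<and> (\<phi> L z, p) \<in> arcs ^^ t)"
  using assms(2)
proof (induction l arbitrary: a)
  case 0
  then show ?case by auto
next
  case (Suc l)
  show ?case
  proof (cases "\<pi> a \<in> {i, j}")
    case True
    then show ?thesis using Suc.prems
      by (intro disjI2 exI[of _ 0] exI[of _ "Suc l"] exI[of _ a]) auto
  next
    case False
    obtain p1 where p1: "(\<phi> L a, p1) \<in> arcs" "(p1, p) \<in> arcs ^^ l"
      using relpow_Suc_E2[OF Suc.prems] .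
    then obtain L' x y where L': "\<phi> L a = \<phi> L' x" "p1 = \<phi> L' y" "L' \<in> Ls" "(x, y) \<in> A"
      unfolding arcs_def by auto
    then have "L' = L" using outside[OF assms(1) L'(3,1) False] by simp
    then have y: "p1 = \<phi> L y" "(a, y) \<in> A" using L' injD[OF inj[OF assms(1)]] by auto
    from Suc.IH[of y] p1(2) y(1) consider
      q where "p = \<phi> L q" "(y, q) \<in> A ^^ l" |
      s t z where "s + t = l" "(y, z) \<in> A ^^ s" "\<pi> z \<in> {i, j}" "(\<phi> L z, p) \<in> arcs ^^ t"
      by blast
    then show ?thesis
    proof cases
      case 1
      then show ?thesis using y(2) relpow_Suc_I2 by metis
    next
      case 2
      then have "Suc s + t = Suc l" "(a, z) \<in> A ^^ Suc s" using y(2) relpow_Suc_I2 by auto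
      then show ?thesis using 2 by blast
    qed
  qed
qed

text \<open>A walk that projects to a geodesic of \<open>W\<close> visits the two parts over \<open>i\<close> and \<open>j\<close> at most
  once each and consecutively, so it never leaves the copy in which it starts and ends.\<close>

lemma geodesic_in_copy:
  assumes L: "L \<in> Ls" and walk: "(\<phi> L a, \<phi> L b) \<in> arcs ^^ l"
    and geodesic: "\<And>k. k < l \<Longrightarrow> (\<pi> a, \<pi> b) \<notin> W ^^ k"
  shows "(a, b) \<in> A ^^ l"
proof -
  note injL = injD[OF inj[OF L]]
  from first_visit[OF L walk] consider "(a, b) \<in> A ^^ l" |
    s t z where "s + t = l" "(a, z) \<in> A ^^ s" "\<pi> z \<in> {i, j}" "(\<phi> L z, \<phi> L b) \<in> arcs ^^ t"
    using injL by blast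
  then show ?thesis
  proof cases
    case (2 s t z)
    \<comment> \<open>Reversing the rest of the walk yields the last visit \<open>z'\<close> to the
      parts over \<open>i\<close> and \<open>j\<close>.\<close>
    from first_visit[OF L sym_relpow[OF sym_arcs 2(4)]] consider "(b, z) \<in> A ^^ t" |
      s' t' z' where "s' + t' = t" "(b, z') \<in> A ^^ s'" "\<pi> z' \<in> {i, j}" "(\<phi> L z', \<phi> L z) \<in> arcs ^^ t'"
      using injL by blast
    then show ?thesis
    proof cases
      case 1
      then show ?thesis using relpow_trans[OF 2(2) sym_relpow[OF sym_A 1]] 2(1) by simp
    next
      case (2 s' t' z')
      note two = \<open>s + t = l\<close> \<open>(a, z) \<in> A ^^ s\<close> \<open>\<pi> z \<in> {i, j}\<close> and two' = 2
      \<comment> \<open>The projections of \<open>z\<close> and \<open>z'\<close> coincide or are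
        the two ends of the edge, so \<open>e\<close> steps of \<open>W\<close> join them.\<close>
      define e where "e = (if \<pi> z = \<pi> z' then 0 else 1 :: nat)"
      have "(\<pi> z, \<pi> z') \<in> W ^^ e"
        using two two' ij symD[OF sym_W ij] by (auto simp: e_def)
      moreover have "(\<pi> a, \<pi> z) \<in> W ^^ s" "(\<pi> z', \<pi> b) \<in> W ^^ s'"
        using relpow_map[of A \<pi> W, OF hom] two two' sym_relpow[OF sym_A] by blast+
      ultimately have "(\<pi> a, \<pi> b) \<in> W ^^ (s + e + s')"
        using relpow_trans by metis
      \<comment> \<open>Here \<open>l = s + t' + s'\<close>, so the middle piece \<open>t'\<close>
        is at most \<open>e\<close>. It is either trivial or a single arc, which
        \<open>induced\<close> puts into \<open>A\<close>.\<close>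
      with geodesic have "l \<le> s + e + s'" using not_le by blast
      then have "t' \<le> 1" using two two' by (auto simp: e_def split: if_splits)
      have "(z', z) \<in> A ^^ t'"
      proof (cases "t' = 0")
        case True
        then show ?thesis using two' injL by auto
      next
        case False
        then have "t' = 1" using \<open>t' \<le> 1\<close> by simp
        then show ?thesis using two' arcs_iff[OF L] by auto
      qed
      then have "(z, b) \<in> A ^^ (t' + s')"
        using relpow_trans sym_relpow[OF sym_A] two'(2) by metis
      from relpow_trans[OF two(2) this] show ?thesis using two two' by (simp add: ac_simps)
    qed
  qed
qed

end

section \<open>Orientations of relations, patterns and hosts\<close>

definition orients :: "'b rel \<Rightarrow> 'b rel \<Rightarrow> bool" where
  "orients D A \<longleftrightarrow> D \<subseteq> A \<and> (\<forall>(a, b) \<in> A. (a, b) \<in> D \<longleftrightarrow> (b, a) \<notin> D)"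

lemma orients_pullback:
  assumes "orients D A'" "sym A" "\<And>x y. (x, y) \<in> A \<Longrightarrow> (f x, f y) \<in> A'"
  shows "orients {(x, y) \<in> A. (f x, f y) \<in> D} A"
  using assms(1,3) symD[OF assms(2)] unfolding orients_def by fastforce

locale pattern =
  fixes VH :: "'h set" and K :: "'h rel"
  assumes finite_VH: "finite VH" and K_VH: "K \<subseteq> VH \<times> VH"
begin

text \<open>Length \<open>0\<close> forces \<open>f\<close> to be injective, and length \<open>1\<close> makes the copy induced.\<close>

definition reflects :: "nat \<Rightarrow> 'b rel \<Rightarrow> ('h \<Rightarrow> 'b) \<Rightarrow> bool" where
  "reflects m A f \<longleftrightarrow> (\<forall>l \<le> m. \<forall>u \<in> VH. \<forall>v \<in> VH. (f u, f v) \<in> A ^^ l \<longrightarrow>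
    (\<exists>k \<le> l. (u, v) \<in> (K \<union> K\<inverse>) ^^ k))"

definition preserves :: "'b rel \<Rightarrow> ('h \<Rightarrow> 'b) \<Rightarrow> bool" where
  "preserves A f \<longleftrightarrow> (\<forall>(u, v) \<in> K. (f u, f v) \<in> A)"

definition host :: "nat \<Rightarrow> 'b rel \<Rightarrow> ('h \<Rightarrow> 'b) set \<Rightarrow> bool" where
  "host m A F \<longleftrightarrow> finite A \<and> sym A \<and> irrefl A \<and> finite F \<and>
    (\<forall>f \<in> F. preserves A f \<and> reflects m A f) \<and>
    (\<forall>D. orients D A \<longrightarrow> (\<exists>f \<in> F. preserves D f))"

end

section \<open>Partite systems over a host\<close>

locale base_host = pattern VH K for VH :: "'h set" and K +
  fixes m :: nat and W :: "'w rel" and FW :: "('h \<Rightarrow> 'w) set"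
  assumes host_W: "host m W FW"
begin

text \<open>In a system over \<open>W\<close>, the copies are found with an orientation that depends, on the arcs over
  \<open>E\<close>, only on the projection to \<open>W\<close>.\<close>

definition system :: "'w rel \<Rightarrow> 'v rel \<Rightarrow> ('v \<Rightarrow> 'w) \<Rightarrow> ('h \<Rightarrow> 'v) set \<Rightarrow> bool" where
  "system E A \<pi> F \<longleftrightarrow> finite A \<and> sym A \<and> finite F \<and> (\<forall>x y. (x, y) \<in> A \<longrightarrow> (\<pi> x, \<pi> y) \<in> W) \<and>
    (\<forall>g \<in> F. preserves A g \<and> reflects (Suc m) A g \<and> (\<exists>f \<in> FW. \<forall>u \<in> VH. \<pi> (g u) = f u)) \<and>
    (\<forall>D. orients D A \<longrightarrow> (\<exists>T. orients T W \<and> (\<forall>f \<in> FW. \<exists>g \<in> F. (\<forall>u \<in> VH. \<pi> (g u) = f u) \<and>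
      (\<forall>(u, v) \<in> K. (f u, f v) \<in> E \<longrightarrow> ((g u, g v) \<in> D \<longleftrightarrow> (f u, f v) \<in> T)))))"

lemma systemI:
  assumes "finite A" "sym A" "finite F" "\<And>x y. (x, y) \<in> A \<Longrightarrow> (\<pi> x, \<pi> y) \<in> W"
    and "\<And>g. g \<in> F \<Longrightarrow> preserves A g" "\<And>g. g \<in> F \<Longrightarrow> reflects (Suc m) A g"
    and "\<And>g. g \<in> F \<Longrightarrow> \<exists>f \<in> FW. \<forall>u \<in> VH. \<pi> (g u) = f u"
    and "\<And>D. orients D A \<Longrightarrow> \<exists>T. orients T W \<and> (\<forall>f \<in> FW. \<exists>g \<in> F. (\<forall>u \<in> VH. \<pi> (g u) = f u) \<and>
      (\<forall>(u, v) \<in> K. (f u, f v) \<in> E \<longrightarrow> ((g u, g v) \<in> D \<longleftrightarrow> (f u, f v) \<in> T)))"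
  shows "system E A \<pi> F"
  using assms unfolding system_def by simp

lemma systemD:
  assumes "system E A \<pi> F"
  shows "finite A" "sym A" "finite F" "\<And>x y. (x, y) \<in> A \<Longrightarrow> (\<pi> x, \<pi> y) \<in> W"
    and "\<And>g. g \<in> F \<Longrightarrow> preserves A g" "\<And>g. g \<in> F \<Longrightarrow> reflects (Suc m) A g"
    and "\<And>g. g \<in> F \<Longrightarrow> \<exists>f \<in> FW. \<forall>u \<in> VH. \<pi> (g u) = f u"
    and "\<And>D. orients D A \<Longrightarrow> \<exists>T. orients T W \<and> (\<forall>f \<in> FW. \<exists>g \<in> F. (\<forall>u \<in> VH. \<pi> (g u) = f u) \<and>
      (\<forall>(u, v) \<in> K. (f u, f v) \<in> E \<longrightarrow> ((g u, g v) \<in> D \<longleftrightarrow> (f u, f v) \<in> T)))"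
  using assms unfolding system_def by simp_all

text \<open>Copies in \<open>FW\<close> have all their arcs in \<open>W\<close>. With
  \<open>E = W\<close> the orientation of the lifted copies is therefore dictated by
  \<open>T\<close>, and a map respected by \<open>T\<close> lifts to one respected by
  \<open>D\<close>.\<close>

lemma system_imp_host:
  assumes "system W A \<pi> F"
  shows "host (Suc m) A F"
proof -
  have "irrefl W" and FW: "\<And>f. f \<in> FW \<Longrightarrow> preserves W f"
    and W: "\<And>T. orients T W \<Longrightarrow> \<exists>f \<in> FW. preserves T f"
    using host_W unfolding host_def by auto
  have "\<exists>g \<in> F. preserves D g" if D: "orients D A" for D
  proof -
    obtain T where T: "orients T W" "\<And>f. f \<in> FW \<Longrightarrow> \<exists>g \<in> F. (\<forall>u \<in> VH. \<pi> (g u) = f u) \<and>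
      (\<forall>(u, v) \<in> K. (f u, f v) \<in> W \<longrightarrow> ((g u, g v) \<in> D \<longleftrightarrow> (f u, f v) \<in> T))"
      using systemD(8)[OF assms D] by blast
    obtain f where f: "f \<in> FW" "preserves T f" using W[OF T(1)] by blast
    obtain g where g: "g \<in> F" "\<forall>(u, v) \<in> K. (f u, f v) \<in> W \<longrightarrow> ((g u, g v) \<in> D \<longleftrightarrow> (f u, f v) \<in> T)"
      using T(2)[OF f(1)] by blast
    then have "preserves D g"
      using f(2) FW[OF f(1)] unfolding preserves_def by fast
    then show ?thesis using g(1) by blast
  qed
  moreover have "irrefl A"
    using systemD(4)[OF assms] \<open>irrefl W\<close> unfolding irrefl_def by blast
  moreover note systemD(1-3,5,6)[OF assms]
  ultimately show ?thesis unfolding host_def by blast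
qed

text \<open>One disjoint copy of the pattern is taken for each map in \<open>FW\<close>. The index
  \<open>f\<close> can be read off each vertex, so a walk never leaves its copy and has the length
  of a walk in the pattern.\<close>

lemma system_empty: "\<exists>(A :: nat rel) \<pi> F. system {} A \<pi> F"
proof -
  have W: "finite W" "sym W" "irrefl W" and FW: "finite FW" "\<And>f. f \<in> FW \<Longrightarrow> preserves W f"
    using host_W unfolding host_def by auto
  obtain e :: "('h \<Rightarrow> 'w) \<times> 'h \<Rightarrow> nat" where e: "inj_on e (FW \<times> VH)"
    using finite_imp_inj_to_nat_seg[of "FW \<times> VH"] FW(1) finite_VH by blast
  define \<pi> where "\<pi> n = (case inv_into (FW \<times> VH) e n of (f, u) \<Rightarrow> f u)" for n
  have \<pi>: "\<pi> (e (f, u)) = f u" if "f \<in> FW" "u \<in> VH" for f u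
    using inv_into_f_f[OF e, of "(f, u)"] that by (simp add: \<pi>_def)
  let ?S = "K \<union> K\<inverse>"
  have S: "u \<in> VH" "v \<in> VH" if "(u, v) \<in> ?S" for u v using that K_VH by auto
  define A where "A = {(e (f, u), e (f, v)) | f u v. f \<in> FW \<and> (u, v) \<in> ?S}"
  define F where "F = (\<lambda>f u. e (f, u)) ` FW"
  have finA: "finite A"
  proof (rule finite_subset)
    show "A \<subseteq> e ` (FW \<times> VH) \<times> e ` (FW \<times> VH)" using S unfolding A_def by blast
    show "finite (e ` (FW \<times> VH) \<times> e ` (FW \<times> VH))" using FW(1) finite_VH by simp
  qed
  have symA: "sym A" unfolding A_def sym_def by blast
  have homA: "(\<pi> x, \<pi> y) \<in> W" if "(x, y) \<in> A" for x y
  proof -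
    obtain f u v where fuv: "x = e (f, u)" "y = e (f, v)" "f \<in> FW" "(u, v) \<in> ?S"
      using \<open>(x, y) \<in> A\<close> unfolding A_def by auto
    have "(f u, f v) \<in> W"
      using fuv(4) FW(2)[OF fuv(3)] symD[OF W(2)] unfolding preserves_def by auto
    then show ?thesis using fuv \<pi> S[OF fuv(4)] by simp
  qed
  have copies: "preserves A g \<and> reflects (Suc m) A g \<and> (\<exists>f \<in> FW. \<forall>u \<in> VH. \<pi> (g u) = f u)"
    if gF: "g \<in> F" for g
  proof -
    obtain f where f: "f \<in> FW" "g = (\<lambda>u. e (f, u))" using gF unfolding F_def by auto
    have walk: "\<exists>v \<in> VH. p = g v \<and> (u, v) \<in> ?S ^^ l" if "(g u, p) \<in> A ^^ l" "u \<in> VH" for u p l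
      using that(1)
    proof (induction l arbitrary: p)
      case 0
      then show ?case using that(2) by auto
    next
      case (Suc l)
      then obtain v where v: "v \<in> VH" "(g v, p) \<in> A" "(u, v) \<in> ?S ^^ l" by fastforce
      then obtain f' x y where xy: "e (f, v) = e (f', x)" "p = e (f', y)" "f' \<in> FW" "(x, y) \<in> ?S"
        unfolding A_def f(2) by blast
      have "(f, v) = (f', x)"
        using inj_onD[OF e xy(1)] v(1) f(1) xy(3) S[OF xy(4)] by blast
      then show ?case using v xy S[OF xy(4)] f(2) by (auto intro: relpow_Suc_I)
    qed
    have "reflects (Suc m) A g"
      unfolding reflects_def
    proof (intro allI ballI impI)
      fix l u v assume "l \<le> Suc m" and uv: "u \<in> VH" "v \<in> VH" and "(g u, g v) \<in> A ^^ l"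
      from walk[OF this(4) uv(1)] obtain v' where v': "v' \<in> VH" "g v = g v'" "(u, v') \<in> ?S ^^ l" by blast
      then have "v = v'" using inj_onD[OF e, of "(f, v)" "(f, v')"] f uv by auto
      then show "\<exists>k\<le>l. (u, v) \<in> ?S ^^ k" using v' by blast
    qed
    moreover have "preserves A g" unfolding preserves_def A_def f(2) using f(1) by blast
    moreover have "\<forall>u \<in> VH. \<pi> (g u) = f u" using \<pi> f by auto
    ultimately show ?thesis using f(1) by blast
  qed
  have ramsey: "\<exists>T. orients T W \<and> (\<forall>f \<in> FW. \<exists>g \<in> F. (\<forall>u \<in> VH. \<pi> (g u) = f u) \<and>
      (\<forall>(u, v) \<in> K. (f u, f v) \<in> {} \<longrightarrow> ((g u, g v) \<in> D \<longleftrightarrow> (f u, f v) \<in> T)))" for D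
  proof -
    have "finite (Field W)" using W(1) by (rule finite_Field)
    then obtain r :: "'w \<Rightarrow> nat" where r: "inj_on r (Field W)"
      by (metis finite_imp_inj_to_nat_seg)
    \<comment> \<open>No arc lies over the empty set, so any orientation of \<open>W\<close> serves;
      this one follows a numbering of its vertices.\<close>
    have "orients {(x, y) \<in> W. r x < r y} W"
      unfolding orients_def
    proof (intro conjI ballI)
      fix p assume "p \<in> W"
      moreover obtain a b where p: "p = (a, b)" by fastforce
      ultimately have ab: "(a, b) \<in> W" "(b, a) \<in> W" "a \<noteq> b" using W symD[OF W(2)] unfolding irrefl_def by auto
      then have "r a \<noteq> r b" using r by (meson FieldI1 inj_onD)
      then show "case p of (a, b) \<Rightarrow>
         ((a, b) \<in> {(x, y). (x, y) \<in> W \<and> r x < r y}) = ((b, a) \<notin> {(x, y). (x, y) \<in> W \<and> r x < r y})"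
        using ab p by auto
    qed auto
    moreover have "\<exists>g \<in> F. \<forall>u \<in> VH. \<pi> (g u) = f u" if "f \<in> FW" for f
      using \<pi> that unfolding F_def by auto
    ultimately show ?thesis by fast
  qed
  have "finite F" unfolding F_def using FW(1) by blast
  have "system {} A \<pi> F"
  proof (rule systemI)
    fix g assume "g \<in> F"
    note copy = copies[OF this]
    show "preserves A g" using copy by blast
    show "reflects (Suc m) A g" using copy by blast
    show "\<exists>f \<in> FW. \<forall>u \<in> VH. \<pi> (g u) = f u" using copy by blast
  qed (rule finA symA homA ramsey \<open>finite F\<close> | assumption)+
  then show ?thesis by blast
qed

text \<open>The letters are the arcs over \<open>(i, j)\<close> and the copies are indexed by the
  combinatorial lines. In the copy \<open>w\<close> the arcs over \<open>(i, j)\<close> become the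
  points of the line \<open>w\<close>, so colouring points by their direction under \<open>D\<close>
  makes a monochromatic line a copy with uniform direction.\<close>

lemma system_step:
  fixes A :: "nat rel"
  assumes sys: "system E A \<pi> F" and ij: "(i, j) \<in> W"
  shows "\<exists>(A' :: nat rel) \<pi>' F'. system (insert (i, j) (insert (j, i) E)) A' \<pi>' F'"
proof -
  have W: "sym W" "irrefl W" and FW: "\<And>f. f \<in> FW \<Longrightarrow> reflects m W f"
    using host_W unfolding host_def by auto
  then have "i \<noteq> j" using ij unfolding irrefl_def by blast
  note A = systemD(1-3)[OF sys] and hom = systemD(4)[OF sys] and F = systemD(5-7)[OF sys]
    and ramsey = systemD(8)[OF sys]
  define X where "X = {(x, y) \<in> A. \<pi> x = i \<and> \<pi> y = j}"
  have "finite X" using A(1) by (rule rev_finite_subset) (auto simp: X_def)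
  have "finite {0, 1 :: nat}" by simp
  from hales_jewett[OF \<open>finite X\<close> this] obtain N where
    N: "\<forall>c. (\<forall>x. set x \<subseteq> X \<and> length x = N \<longrightarrow> c x \<in> {0, 1 :: nat}) \<longrightarrow>
    (\<exists>w k. length w = N \<and> None \<in> set w \<and> set w \<subseteq> insert None (Some ` X) \<and> (\<forall>z \<in> X. c (fill z w) = k))" ..
  define Ls where "Ls = {w. length w = N \<and> None \<in> set w \<and> set w \<subseteq> insert None (Some ` X)}"
  \<comment> \<open>A word of arcs is unzipped into a word of sources over \<open>i\<close> and a
    word of targets over \<open>j\<close>; these words are shared between copies. All other vertices
    carry the tag \<open>w\<close> and stay disjoint.\<close>
  define \<phi>0 where "\<phi>0 w v = (if \<pi> v = i then Inl (fill v (map (map_option fst) w))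
    else if \<pi> v = j then Inl (fill v (map (map_option snd) w)) else Inr (w, v))" for w v
  \<comment> \<open>Coding back into \<open>nat\<close> keeps the type fixed while the edges of
    \<open>W\<close> are treated one after another.\<close>
  define \<phi> where "\<phi> w v = to_nat (\<phi>0 w v)" for w v
  \<comment> \<open>All letters of a shared word lie over the same vertex of \<open>W\<close>, so
    its head determines the part. Words from \<open>Ls\<close> contain \<open>None\<close> and hence
    are not empty.\<close>
  define \<pi>' where "\<pi>' p = (case from_nat p :: nat list + (nat \<times> nat) option list \<times> nat of
    Inl xs \<Rightarrow> \<pi> (hd xs) | Inr (w, v) \<Rightarrow> \<pi> v)" for p
  have \<phi>_eq: "\<phi> w v = \<phi> w' v' \<longleftrightarrow> \<phi>0 w v = \<phi>0 w' v'" for w v w' v'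
    by (simp add: \<phi>_def)
  have proj: "\<pi>' (\<phi> w v) = \<pi> v" if "w \<in> Ls" for w v
  proof -
    have "w \<noteq> []" using that by (auto simp: Ls_def)
    moreover have "set (map (map_option fst) w) \<subseteq> insert None (Some ` {v. \<pi> v = i})"
      "set (map (map_option snd) w) \<subseteq> insert None (Some ` {v. \<pi> v = j})"
      using that by (auto simp: Ls_def X_def)
    ultimately have "hd (fill v (map (map_option fst) w)) \<in> insert v {v. \<pi> v = i}"
      "hd (fill v (map (map_option snd) w)) \<in> insert v {v. \<pi> v = j}"
      by (intro hd_fill_mem; simp)+
    then have "\<pi> v = i \<Longrightarrow> \<pi> (hd (fill v (map (map_option fst) w))) = i"
      "\<pi> v = j \<Longrightarrow> \<pi> (hd (fill v (map (map_option snd) w))) = j"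
      by auto
    then show ?thesis by (simp add: \<pi>'_def \<phi>_def \<phi>0_def)
  qed
  have same_part: "\<pi> x = \<pi> y" if "w \<in> Ls" "w' \<in> Ls" "\<phi> w x = \<phi> w' y" for w w' x y
    using proj that by metis
  have inj: "inj (\<phi> w)" if "w \<in> Ls" for w
  proof (rule injI)
    fix x y assume eq: "\<phi> w x = \<phi> w y"
    have "None \<in> set (map (map_option h) w)" for h :: "nat \<times> nat \<Rightarrow> nat"
      using that by (force simp: Ls_def)
    note fill_inj = fill_None_inj[OF this]
    show "x = y"
      using eq same_part[OF that that eq] unfolding \<phi>_eq \<phi>0_def
      by (auto dest: fill_inj split: if_splits)
  qed
  have outside: "w = w'" if "w \<in> Ls" "w' \<in> Ls" "\<phi> w x = \<phi> w' y" "\<pi> x \<notin> {i, j}" for w w' x y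
    using that(3,4) same_part[OF that(1-3)] unfolding \<phi>_eq \<phi>0_def by auto
  \<comment> \<open>The only delicate overlap: both ends are shared words. By
    \<open>fill_pair_mem\<close> the pair is \<open>(u', v')\<close> or a letter of
    \<open>X\<close>, hence an arc of \<open>A\<close> in either case.\<close>
  have fibre: "(u, v) \<in> A" if "w \<in> Ls" "w' \<in> Ls" "(u', v') \<in> A" "\<phi> w u = \<phi> w' u'" "\<phi> w v = \<phi> w' v'"
    "\<pi> u = i" "\<pi> v = j" for w w' u v u' v'
  proof -
    have "\<pi> u' = i" "\<pi> v' = j" using same_part that by metis+
    then have "(u, v) \<in> insert (u', v') X"
      using that \<open>i \<noteq> j\<close> unfolding \<phi>_eq \<phi>0_def by (intro fill_pair_mem[of w w']) (auto simp: Ls_def)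
    then show ?thesis using that(3) by (auto simp: X_def)
  qed
  have induced: "(u, v) \<in> A" if w: "w \<in> Ls" "w' \<in> Ls" and uv': "(u', v') \<in> A"
    and eq: "\<phi> w u = \<phi> w' u'" "\<phi> w v = \<phi> w' v'" for w w' u v u' v'
  proof -
    have parts: "\<pi> u = \<pi> u'" "\<pi> v = \<pi> v'" using same_part w eq by blast+
    then have "\<pi> u \<noteq> \<pi> v" using hom[OF uv'] W(2) unfolding irrefl_def by auto
    then consider "\<pi> u \<notin> {i, j}" | "\<pi> v \<notin> {i, j}" | "\<pi> u = i" "\<pi> v = j" | "\<pi> u = j" "\<pi> v = i"
      by fastforce
    then show ?thesis
    proof cases
      case 1
      then have "w = w'" using outside[OF w eq(1)] by blast
      then show ?thesis using uv' eq injD[OF inj[OF w(1)]] by auto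
    next
      case 2
      then have "w = w'" using outside[OF w eq(2)] by blast
      then show ?thesis using uv' eq injD[OF inj[OF w(1)]] by auto
    next
      case 3
      then show ?thesis using fibre[OF w uv' eq] by blast
    next
      case 4
      then show ?thesis using fibre[OF w symD[OF A(2) uv'] eq(2,1)] symD[OF A(2)] by blast
    qed
  qed
  interpret amalgam W i j A \<pi> Ls \<phi> \<pi>'
    using W(1) ij A(2) hom inj proj outside induced by unfold_locales
  define F' where "F' = (\<lambda>(w, g) u. \<phi> w (g u)) ` (Ls \<times> F)"
  have "finite Ls"
  proof (rule finite_subset)
    show "Ls \<subseteq> {w. set w \<subseteq> insert None (Some ` X) \<and> length w = N}" by (auto simp: Ls_def)
    show "finite {w. set w \<subseteq> insert None (Some ` X) \<and> length w = N}"
      using \<open>finite X\<close> by (intro finite_lists_length_eq) simp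
  qed
  have "system (insert (i, j) (insert (j, i) E)) arcs \<pi>' F'"
  proof (rule systemI)
    show "finite arcs"
    proof (rule finite_subset)
      show "arcs \<subseteq> (\<lambda>(w, x, y). (\<phi> w x, \<phi> w y)) ` (Ls \<times> A)" unfolding arcs_def by force
      show "finite ((\<lambda>(w, x, y). (\<phi> w x, \<phi> w y)) ` (Ls \<times> A))" using \<open>finite Ls\<close> A(1) by blast
    qed
    show "sym arcs" by (rule sym_arcs)
    show "finite F'" unfolding F'_def using \<open>finite Ls\<close> A(3) by blast
    show "(\<pi>' p, \<pi>' q) \<in> W" if "(p, q) \<in> arcs" for p q using that by (rule arcs_proj)
  next
    fix g' assume "g' \<in> F'"
    then obtain w g where w: "w \<in> Ls" and g: "g \<in> F" and g': "g' = (\<lambda>u. \<phi> w (g u))"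
      unfolding F'_def by auto
    show "preserves arcs g'"
      using F(1)[OF g] unfolding preserves_def g' arcs_iff[OF w] .
    obtain f where f: "f \<in> FW" "\<And>u. u \<in> VH \<Longrightarrow> \<pi> (g u) = f u" using F(3)[OF g] by blast
    then show "\<exists>f \<in> FW. \<forall>u \<in> VH. \<pi>' (g' u) = f u" using proj[OF w] g' by auto
    show "reflects (Suc m) arcs g'"
      unfolding reflects_def
    proof (intro allI ballI impI)
      fix l u v assume l: "l \<le> Suc m" and uv: "u \<in> VH" "v \<in> VH" and walk: "(g' u, g' v) \<in> arcs ^^ l"
      show "\<exists>k \<le> l. (u, v) \<in> (K \<union> K\<inverse>) ^^ k"
      proof (cases "\<exists>k < l. (\<pi> (g u), \<pi> (g v)) \<in> W ^^ k")
        case True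
        then obtain k where k: "k < l" "(f u, f v) \<in> W ^^ k" using f uv by auto
        \<comment> \<open>A proper shortcut of a walk of length at most \<open>m + 1\<close> has
          length at most \<open>m\<close>, the range in which \<open>W\<close> already reflects
          distances.\<close>
        then have "k \<le> m" using l by simp
        then obtain k' where "k' \<le> k" "(u, v) \<in> (K \<union> K\<inverse>) ^^ k'"
          using FW[OF f(1)] uv k(2) unfolding reflects_def by blast
        then show ?thesis using k(1) by (meson less_imp_le order_trans)
      next
        case False
        then have "(g u, g v) \<in> A ^^ l"
          using geodesic_in_copy[OF w] walk unfolding g' by blast
        then show ?thesis using F(2)[OF g] l uv unfolding reflects_def by blast
      qed
    qed
  next
    fix D assume D: "orients D arcs"
    \<comment> \<open>The word \<open>x\<close> of arcs is a point of the cube; its colour tells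
      whether the arc between its unzipped vertex words is directed from the part over
      \<open>i\<close> to the part over \<open>j\<close>.\<close>
    define c where "c x = (if (to_nat (Inl (map fst x) :: nat list + (nat \<times> nat) option list \<times> nat),
      to_nat (Inl (map snd x) :: nat list + (nat \<times> nat) option list \<times> nat)) \<in> D then 1 else 0 :: nat)"
      for x :: "(nat \<times> nat) list"
    have "\<forall>x. set x \<subseteq> X \<and> length x = N \<longrightarrow> c x \<in> {0, 1}" by (simp add: c_def)
    from N[THEN spec, THEN mp, OF this] obtain w k where w: "w \<in> Ls" and k: "\<And>z. z \<in> X \<Longrightarrow> c (fill z w) = k"
      unfolding Ls_def by blast
    have mono: "(\<phi> w x, \<phi> w y) \<in> D \<longleftrightarrow> k = 1" if "(x, y) \<in> A" "\<pi> x = i" "\<pi> y = j" for x y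
    proof -
      have "c (fill (x, y) w) = k" using k that by (simp add: X_def)
      then show ?thesis using that \<open>i \<noteq> j\<close>
        by (auto simp: c_def map_fst_fill map_snd_fill \<phi>_def \<phi>0_def split: if_splits)
    qed
    have D_iff: "(\<phi> w x, \<phi> w y) \<in> D \<longleftrightarrow> (\<phi> w y, \<phi> w x) \<notin> D" if "(x, y) \<in> A" for x y
      using D that arcs_iff[OF w] unfolding orients_def by fastforce
    have "orients {(x, y) \<in> A. (\<phi> w x, \<phi> w y) \<in> D} A"
      by (rule orients_pullback[OF D A(2)]) (simp add: arcs_iff[OF w])
    from ramsey[OF this] obtain T where T: "orients T W"
      and TF: "\<And>f. f \<in> FW \<Longrightarrow> \<exists>g \<in> F. (\<forall>u \<in> VH. \<pi> (g u) = f u) \<and> (\<forall>(u, v) \<in> K. (f u, f v) \<in> E \<longrightarrow>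
        ((g u, g v) \<in> {(x, y) \<in> A. (\<phi> w x, \<phi> w y) \<in> D} \<longleftrightarrow> (f u, f v) \<in> T))"
      by blast
    \<comment> \<open>\<open>T\<close> is kept on the edges treated before and overwritten on the
      current edge by the common direction \<open>k\<close>.\<close>
    define T' where "T' = insert (if k = 1 then (i, j) else (j, i)) (T - {(i, j), (j, i)})"
    have "orients T' W"
      using T ij symD[OF W(1) ij] \<open>i \<noteq> j\<close> unfolding orients_def T'_def by auto
    moreover have "\<exists>g \<in> F'. (\<forall>u \<in> VH. \<pi>' (g u) = f u) \<and>
      (\<forall>(u, v) \<in> K. (f u, f v) \<in> insert (i, j) (insert (j, i) E) \<longrightarrow>
        ((g u, g v) \<in> D \<longleftrightarrow> (f u, f v) \<in> T'))" if fFW: "f \<in> FW" for f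
    proof -
      from TF[OF fFW] obtain g where g: "g \<in> F" "\<And>u. u \<in> VH \<Longrightarrow> \<pi> (g u) = f u"
        and gT: "\<And>u v. (u, v) \<in> K \<Longrightarrow> (f u, f v) \<in> E \<Longrightarrow>
          (g u, g v) \<in> {(x, y) \<in> A. (\<phi> w x, \<phi> w y) \<in> D} \<longleftrightarrow> (f u, f v) \<in> T"
        by blast
      have "(\<phi> w (g u), \<phi> w (g v)) \<in> D \<longleftrightarrow> (f u, f v) \<in> T'"
        if uv: "(u, v) \<in> K" "(f u, f v) \<in> insert (i, j) (insert (j, i) E)" for u v
      proof -
        have gA: "(g u, g v) \<in> A" using F(1)[OF g(1)] uv(1) unfolding preserves_def by auto
        have \<pi>g: "\<pi> (g u) = f u" "\<pi> (g v) = f v" using g(2) uv(1) K_VH by auto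
        consider "(f u, f v) = (i, j)" | "(f u, f v) = (j, i)" |
          "(f u, f v) \<in> E" "(f u, f v) \<notin> {(i, j), (j, i)}"
          using uv(2) by blast
        then show ?thesis
        proof cases
          case 1
          then show ?thesis using mono[OF gA] \<pi>g \<open>i \<noteq> j\<close> by (auto simp: T'_def)
        next
          case 2
          then show ?thesis using mono[OF symD[OF A(2) gA]] D_iff[OF gA] \<pi>g \<open>i \<noteq> j\<close> by (auto simp: T'_def)
        next
          case 3
          then show ?thesis using gT[OF uv(1) 3(1)] gA by (auto simp: T'_def)
        qed
      qed
      moreover have "(\<lambda>u. \<phi> w (g u)) \<in> F'" unfolding F'_def using w g(1) by force
      ultimately show ?thesis using proj[OF w] g(2)
        by (intro bexI[of _ "\<lambda>u. \<phi> w (g u)"]) auto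
    qed
    ultimately show "\<exists>T. orients T W \<and> (\<forall>f \<in> FW. \<exists>g \<in> F'. (\<forall>u \<in> VH. \<pi>' (g u) = f u) \<and>
      (\<forall>(u, v) \<in> K. (f u, f v) \<in> insert (i, j) (insert (j, i) E) \<longrightarrow>
        ((g u, g v) \<in> D \<longleftrightarrow> (f u, f v) \<in> T)))"
      by blast
  qed
  then show ?thesis by blast
qed

text \<open>The edges of \<open>W\<close> are treated one at a time, starting from disjoint copies.
  Each step settles an edge in both directions, hence the symmetric closure of \<open>E\<close>,
  which is \<open>W\<close> itself at the end.\<close>

lemma host_Suc: "\<exists>(A :: nat rel) F. host (Suc m) A F"
proof -
  have W: "finite W" "sym W" using host_W unfolding host_def by auto
  have "\<exists>(A :: nat rel) \<pi> F. system (E \<union> E\<inverse>) A \<pi> F" if "finite E" "E \<subseteq> W" for E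
    using that
  proof (induction E rule: finite_induct)
    case empty
    show ?case using system_empty by simp
  next
    case (insert p E)
    obtain i j where p: "p = (i, j)" by fastforce
    obtain A :: "nat rel" and \<pi> F where "system (E \<union> E\<inverse>) A \<pi> F" using insert by blast
    from system_step[OF this, of i j] insert.prems
    obtain A' :: "nat rel" and \<pi>' F' where "system (insert (i, j) (insert (j, i) (E \<union> E\<inverse>))) A' \<pi>' F'"
      unfolding p by blast
    moreover have "insert (i, j) (insert (j, i) (E \<union> E\<inverse>)) = insert p E \<union> (insert p E)\<inverse>"
      unfolding p by blast
    ultimately show ?case by metis
  qed
  from this[OF W(1) subset_refl] W(2) show ?thesis
    using system_imp_host by (metis sym_conv_converse_eq sup.idem)
qed

end

section \<open>Complete graphs as initial hosts\<close>

text \<open>Fix a vertex \<open>v\<close>. Of its out-neighbours \<open>P\<close> and in-neighbours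
  \<open>Q\<close> one set has at least \<open>2 ^ n\<close> elements; recurse there and put
  \<open>v\<close> in front or at the end.\<close>

lemma transitive_subtournament:
  assumes "finite V" "2 ^ n \<le> card V" "\<And>x y. x \<in> V \<Longrightarrow> y \<in> V \<Longrightarrow> x \<noteq> y \<Longrightarrow> (x, y) \<in> D \<or> (y, x) \<in> D"
  shows "\<exists>xs. distinct xs \<and> length xs = n \<and> set xs \<subseteq> V \<and> sorted_wrt (\<lambda>x y. (x, y) \<in> D) xs"
  using assms
proof (induction n arbitrary: V)
  case 0
  then show ?case by auto
next
  case (Suc n)
  have "V \<noteq> {}" using Suc.prems(2) by auto
  then obtain v where v: "v \<in> V" by blast
  define P where "P = {x \<in> V - {v}. (v, x) \<in> D}"
  define Q where "Q = {x \<in> V - {v}. (x, v) \<in> D}"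
  have fin: "finite P" "finite Q" using Suc.prems(1) by (auto simp: P_def Q_def)
  have "V = insert v (P \<union> Q)" using Suc.prems(3) v by (auto simp: P_def Q_def)
  then have "card V \<le> Suc (card (P \<union> Q))" by (metis card_insert_le_m1 card_insert_if finite_UnI fin le_Suc_eq order_refl)
  also have "\<dots> \<le> Suc (card P + card Q)" using card_Un_le by auto
  finally have "2 ^ n \<le> card P \<or> 2 ^ n \<le> card Q" using Suc.prems(2) by (cases "2 ^ n \<le> card P") auto
  then show ?case
  proof
    assume "2 ^ n \<le> card P"
    with Suc.IH[of P] fin Suc.prems(3) obtain xs where
      "distinct xs" "length xs = n" "set xs \<subseteq> P" "sorted_wrt (\<lambda>x y. (x, y) \<in> D) xs"
      by (auto simp: P_def)
    then show ?thesis using v by (intro exI[of _ "v # xs"]) (auto simp: P_def)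
  next
    assume "2 ^ n \<le> card Q"
    with Suc.IH[of Q] fin Suc.prems(3) obtain xs where
      "distinct xs" "length xs = n" "set xs \<subseteq> Q" "sorted_wrt (\<lambda>x y. (x, y) \<in> D) xs"
      by (auto simp: Q_def)
    then show ?thesis using v by (intro exI[of _ "xs @ [v]"]) (auto simp: Q_def sorted_wrt_append)
  qed
qed

lemma topological_order:
  assumes "finite V" "wf K"
  shows "\<exists>xs. distinct xs \<and> set xs = V \<and> sorted_wrt (\<lambda>x y. (y, x) \<notin> K) xs"
  using assms(1)
proof (induction V rule: finite_psubset_induct)
  case (psubset V)
  show ?case
  proof (cases "V = {}")
    case False
    then obtain z where z: "z \<in> V" "\<And>y. (y, z) \<in> K \<Longrightarrow> y \<notin> V"
      using wfE_min[OF assms(2)] by blast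
    obtain xs where "distinct xs" "set xs = V - {z}" "sorted_wrt (\<lambda>x y. (y, x) \<notin> K) xs"
      using psubset.IH[of "V - {z}"] z(1) by blast
    then show ?thesis using z by (intro exI[of _ "z # xs"]) auto
  qed simp
qed

text \<open>In a complete graph on \<open>2 ^ card VH\<close> vertices a topological order of the
  pattern is laid along a transitive subtournament. At length \<open>0\<close> only injectivity has
  to be ensured.\<close>

lemma (in pattern) host_0:
  assumes "acyclic K"
  shows "\<exists>(A :: nat rel) F. host 0 A F"
proof -
  define r :: nat where "r = 2 ^ card VH"
  define A where "A = {(x, y). x < r \<and> y < r \<and> x \<noteq> y}"
  \<comment> \<open>Extensional maps, so that there are finitely many even if the type
    \<open>'h\<close> is infinite.\<close>
  define F where "F = {f \<in> VH \<rightarrow>\<^sub>E {..<r}. inj_on f VH}"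
  have K_neq: "u \<noteq> v" if "(u, v) \<in> K" for u v
    using assms that unfolding acyclic_def by blast
  have "finite K" using K_VH finite_VH by (simp add: finite_subset)
  then have "wf K" using assms by (rule finite_acyclic_wf)
  have "finite (VH \<rightarrow>\<^sub>E {..<r})" using finite_VH by (intro finite_PiE) auto
  then have "finite F" by (simp add: F_def)
  have "A \<subseteq> {..<r} \<times> {..<r}" by (auto simp: A_def)
  then have "finite A" by (rule finite_subset) simp
  have "preserves A f" if "f \<in> F" for f
    unfolding preserves_def
  proof (intro ballI, clarify)
    fix u v assume uv: "(u, v) \<in> K"
    then have "u \<in> VH" "v \<in> VH" "u \<noteq> v" using K_VH K_neq by auto
    then show "(f u, f v) \<in> A" using that by (auto simp: F_def A_def inj_on_def)
  qed
  moreover have "reflects 0 A f" if "f \<in> F" for f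
    using that by (auto simp: F_def reflects_def inj_on_def)
  moreover have "\<exists>f \<in> F. preserves D f" if D: "orients D A" for D
  proof -
    have tournament: "(x, y) \<in> D \<or> (y, x) \<in> D" if "x \<in> {..<r}" "y \<in> {..<r}" "x \<noteq> y" for x y
    proof -
      have "(x, y) \<in> A" using that by (simp add: A_def)
      then show ?thesis using D unfolding orients_def by blast
    qed
    have "2 ^ card VH \<le> card {..<r}" by (simp add: r_def)
    from transitive_subtournament[OF finite_lessThan this tournament] obtain ys where ys: "distinct ys" "length ys = card VH" "set ys \<subseteq> {..<r}"
      "sorted_wrt (\<lambda>x y. (x, y) \<in> D) ys" by blast
    obtain xs where xs: "distinct xs" "set xs = VH" "sorted_wrt (\<lambda>x y. (y, x) \<notin> K) xs"
      using topological_order[OF finite_VH \<open>wf K\<close>] by blast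
    have len: "length xs = card VH" using xs distinct_card by metis
    define idx where "idx u = (SOME k. k < card VH \<and> xs ! k = u)" for u
    have idx: "idx u < card VH \<and> xs ! idx u = u" if "u \<in> VH" for u
    proof -
      have "\<exists>k. k < card VH \<and> xs ! k = u" using that xs(2) len by (metis in_set_conv_nth)
      then show ?thesis unfolding idx_def by (rule someI_ex)
    qed
    define f where "f = (\<lambda>u \<in> VH. ys ! idx u)"
    have "inj_on f VH"
      unfolding inj_on_def
    proof (intro ballI impI)
      fix u v assume uv: "u \<in> VH" "v \<in> VH" "f u = f v"
      then have "idx u = idx v" using idx ys(1,2) by (simp add: f_def nth_eq_iff_index_eq)
      then show "u = v" using idx uv(1,2) by metis
    qed
    moreover have "f \<in> VH \<rightarrow>\<^sub>E {..<r}"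
    proof -
      have "ys ! idx u \<in> {..<r}" if "u \<in> VH" for u
        using idx[OF that] ys(2,3) by (metis nth_mem subsetD)
      then show ?thesis by (simp add: f_def)
    qed
    moreover have "(f u, f v) \<in> D" if uv: "(u, v) \<in> K" for u v
    proof -
      have VH: "u \<in> VH" "v \<in> VH" "u \<noteq> v" using uv K_VH K_neq by auto
      \<comment> \<open>Otherwise \<open>v\<close> would precede \<open>u\<close> in the topological
        order, against \<open>(u, v) \<in> K\<close>.\<close>
      have "\<not> idx v < idx u"
        using sorted_wrt_nth_less[OF xs(3), of "idx v" "idx u"] idx[OF VH(1)] idx[OF VH(2)] uv len
        by auto
      moreover have "idx u \<noteq> idx v" using idx VH by metis
      ultimately have "idx u < idx v" by simp
      then show ?thesis
        using sorted_wrt_nth_less[OF ys(4)] idx[OF VH(2)] VH ys(2) by (simp add: f_def)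
    qed
    ultimately show ?thesis unfolding F_def preserves_def by blast
  qed
  moreover have "sym A" "irrefl A" by (auto simp: A_def sym_def irrefl_def)
  ultimately have "host 0 A F" unfolding host_def using \<open>finite A\<close> \<open>finite F\<close> by blast
  then show ?thesis by blast
qed

lemma (in pattern) host_exists:
  assumes "acyclic K"
  shows "\<exists>(A :: nat rel) F. host m A F"
proof (induction m)
  case 0
  show ?case using host_0[OF assms] .
next
  case (Suc m)
  then obtain A :: "nat rel" and F where "host m A F" by blast
  then interpret base_host VH K m A F by unfold_locales
  show ?case by (rule host_Suc)
qed

section \<open>Distances and isometric copies\<close>

lemma (in pair_wf_digraph) length_awalk_to_apath:
  assumes "awalk u p v"
  shows "length (awalk_to_apath p) \<le> length p"
  using assms
proof (induct rule: awalk_to_apath_induct)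
  case (path p)
  then have "awalk_to_apath p = p" by (auto simp: awalk_to_apath.simps)
  then show ?case by simp
next
  case (decomp p q r s)
  then have "p = q @ r @ s" by (elim awalk_cyc_decompE)
  moreover have "awalk_to_apath p = awalk_to_apath (q @ s)"
    using decomp step_awalk_to_apath[of _ p _ q r s] by simp
  ultimately show ?case using decomp by simp
qed

lemma (in pair_wf_digraph) awalk_imp_relpow: "awalk u p v \<Longrightarrow> (u, v) \<in> parcs G ^^ length p"
proof (induction p arbitrary: u)
  case Nil
  then show ?case by (simp add: awalk_Nil_iff)
next
  case (Cons a p)
  then show ?case by (auto simp: awalk_Cons_iff intro!: relpow_Suc_I2 simp del: relpow.simps)
qed

lemma (in pair_wf_digraph) relpow_imp_awalk:
  "(u, v) \<in> parcs G ^^ l \<Longrightarrow> u \<in> pverts G \<Longrightarrow> \<exists>p. awalk u p v \<and> length p = l"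
proof (induction l arbitrary: u)
  case 0
  then show ?case by (intro exI[of _ "[]"]) (auto simp: awalk_Nil_iff)
next
  case (Suc l)
  then obtain w where w: "(u, w) \<in> parcs G" "(w, v) \<in> parcs G ^^ l" by (meson relpow_Suc_E2)
  then obtain p where "awalk w p v" "length p = l" using Suc.IH in_arcsD2 by blast
  then show ?case using w by (intro exI[of _ "(u, w) # p"]) (auto simp: awalk_Cons_iff)
qed

text \<open>Cutting the cycles out of a walk leaves a path that is no longer, so paths and walks
  give the same infimum. Distances thereby take the form in which \<open>reflects\<close> speaks of
  them.\<close>

lemma graph_dist_relpow:
  assumes "pair_wf_digraph G" "u \<in> pverts G"
  shows "graph_dist G u v = (INF l \<in> {l. (u, v) \<in> (parcs G \<union> (parcs G)\<inverse>) ^^ l}. enat l)"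
proof -
  interpret G: pair_wf_digraph G by (rule assms)
  interpret M: pair_wf_digraph "mk_symmetric (with_proj G)"
    by (rule G.wellformed_mk_symmetric)
  have arcs: "parcs (mk_symmetric (with_proj G)) = parcs G \<union> (parcs G)\<inverse>"
    by (auto simp: parcs_mk_symmetric)
  show ?thesis
    unfolding graph_dist_def
  proof (rule antisym)
    show "(INF p \<in> {p. M.apath u p v}. enat (length p)) \<le>
      (INF l \<in> {l. (u, v) \<in> (parcs G \<union> (parcs G)\<inverse>) ^^ l}. enat l)"
    proof (rule INF_mono)
      fix l assume "l \<in> {l. (u, v) \<in> (parcs G \<union> (parcs G)\<inverse>) ^^ l}"
      then obtain p where "M.awalk u p v" "length p = l"
        using M.relpow_imp_awalk[of u v l] assms(2) arcs by auto
      then show "\<exists>p \<in> {p. M.apath u p v}. enat (length p) \<le> enat l"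
        using M.apath_awalk_to_apath M.length_awalk_to_apath by (metis enat_ord_simps(1) mem_Collect_eq)
    qed
    show "(INF l \<in> {l. (u, v) \<in> (parcs G \<union> (parcs G)\<inverse>) ^^ l}. enat l) \<le>
      (INF p \<in> {p. M.apath u p v}. enat (length p))"
    proof (rule INF_mono)
      fix p assume "p \<in> {p. M.apath u p v}"
      then have "M.awalk u p v" by (auto intro: M.awalkI_apath)
      then have "(u, v) \<in> (parcs G \<union> (parcs G)\<inverse>) ^^ length p"
        using M.awalk_imp_relpow unfolding arcs by blast
      then show "\<exists>l \<in> {l. (u, v) \<in> (parcs G \<union> (parcs G)\<inverse>) ^^ l}. enat l \<le> enat (length p)"
        by blast
    qed
  qed
qed

lemma acyclic_digraph_imp_acyclic:
  assumes "pair_wf_digraph H" "acyclic_digraph H"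
  shows "acyclic (parcs H)"
proof -
  interpret pair_wf_digraph H by (rule assms)
  show ?thesis
    unfolding acyclic_def
  proof (intro allI notI)
    fix x assume "(x, x) \<in> (parcs H)\<^sup>+"
    then obtain p where "awalk x p x" "p \<noteq> []" using reachable1_awalk by blast
    then have "closed_w p" unfolding closed_w_def by blast
    then show False using closed_w_imp_cycle assms(2) unfolding acyclic_digraph_def by blast
  qed
qed

text \<open>\<open>G\<close> contains a separate copy \<open>e c\<close> of the host for each vertex
  \<open>c\<close> of \<open>H\<close>, closed under adjacency. Each component of \<open>H\<close>
  is embedded in the copy indexed by its representative, so different components land at infinite
  distance.\<close>

lemma isometric_arrowI:
  fixes H :: "'a pair_pre_digraph" and G :: "'g pair_pre_digraph" and e :: "'a \<Rightarrow> 'b \<Rightarrow> 'g"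
  defines "K \<equiv> parcs H"
  assumes H: "pair_digraph H" and G: "pair_graph G"
    and host: "pattern.host (pverts H) K (Suc (card (K \<union> K\<inverse>))) A F"
    and e_inj: "\<And>c c' x y. c \<in> pverts H \<Longrightarrow> c' \<in> pverts H \<Longrightarrow> e c x = e c' y \<Longrightarrow> c = c' \<and> x = y"
    and e_arcs: "\<And>c x y. c \<in> pverts H \<Longrightarrow> (x, y) \<in> A \<Longrightarrow> (e c x, e c y) \<in> parcs G"
    and e_closed: "\<And>c x q. c \<in> pverts H \<Longrightarrow> (e c x, q) \<in> parcs G \<Longrightarrow> \<exists>y. q = e c y \<and> (x, y) \<in> A"
    and e_verts: "\<And>c f u. c \<in> pverts H \<Longrightarrow> f \<in> F \<Longrightarrow> u \<in> pverts H \<Longrightarrow> e c (f u) \<in> pverts G"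
  shows "isometric_arrow G H"
  unfolding isometric_arrow_def
proof (intro allI impI)
  interpret H: pair_digraph H by (rule H)
  interpret G: pair_graph G by (rule G)
  let ?V = "pverts H" and ?S = "K \<union> K\<inverse>"
  interpret pattern ?V K
    using H.pair_finite_verts H.in_arcsD1 H.in_arcsD2 unfolding K_def by unfold_locales auto
  have A: "sym A" "irrefl A" and F: "\<And>f. f \<in> F \<Longrightarrow> preserves A f" "\<And>f. f \<in> F \<Longrightarrow> reflects (Suc (card ?S)) A f"
    and AF: "\<And>D. orients D A \<Longrightarrow> \<exists>f \<in> F. preserves D f"
    using host unfolding host_def by auto
  have symG: "sym (parcs G)" using G.pair_sym_arcs by (simp add: symmetric_def)
  have "finite K" using H.pair_finite_arcs by (simp add: K_def)
  then have "finite ?S" by simp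
  fix D assume "orientation D G"
  then have D: "orients (parcs D) (parcs G)"
    unfolding orientation_def orients_def by blast
  then have D_sub: "parcs D \<subseteq> parcs G"
    and D_iff: "\<And>a b. (a, b) \<in> parcs G \<Longrightarrow> (a, b) \<in> parcs D \<longleftrightarrow> (b, a) \<notin> parcs D"
    unfolding orients_def by blast+
  have "orients {(x, y) \<in> A. (e c x, e c y) \<in> parcs D} A" if "c \<in> ?V" for c
    using e_arcs[OF that] by (intro orients_pullback[OF D A(1)])
  then have "\<forall>c \<in> ?V. \<exists>f. f \<in> F \<and> preserves {(x, y) \<in> A. (e c x, e c y) \<in> parcs D} f"
    using AF by blast
  from bchoice[OF this] obtain h where h: "\<And>c. c \<in> ?V \<Longrightarrow> h c \<in> F"
    "\<And>c. c \<in> ?V \<Longrightarrow> preserves {(x, y) \<in> A. (e c x, e c y) \<in> parcs D} (h c)"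
    by blast
  \<comment> \<open>The predicate under \<open>SOME\<close> depends only on the component of
    \<open>u\<close>, so connected vertices receive the same representative.\<close>
  define rep where "rep u = (SOME c. c \<in> ?V \<and> (u, c) \<in> ?S\<^sup>*)" for u
  have "\<exists>c. c \<in> ?V \<and> (u, c) \<in> ?S\<^sup>*" if "u \<in> ?V" for u using that by blast
  then have rep: "rep u \<in> ?V" "(u, rep u) \<in> ?S\<^sup>*" if "u \<in> ?V" for u
    using someI_ex[of "\<lambda>c. c \<in> ?V \<and> (u, c) \<in> ?S\<^sup>*"] that unfolding rep_def by blast+
  have symS: "sym ?S" by (auto simp: sym_def)
  have rep_step: "rep u = rep v" if "(u, v) \<in> ?S" for u v
  proof -
    have "(u, c) \<in> ?S\<^sup>* \<longleftrightarrow> (v, c) \<in> ?S\<^sup>*" for c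
      using that symD[OF symS that] by (meson converse_rtrancl_into_rtrancl)
    then show ?thesis by (simp add: rep_def)
  qed
  have rep_conn: "(u, v) \<in> ?S\<^sup>*" if "u \<in> ?V" "v \<in> ?V" "rep u = rep v" for u v
    using rep(2)[OF that(1)] rep(2)[OF that(2)] that(3) sym_rtrancl[OF symS]
    by (metis rtrancl_trans symD)
  define f where "f u = e (rep u) (h (rep u) u)" for u
  have f_verts: "f u \<in> pverts G" if "u \<in> ?V" for u
    unfolding f_def using e_verts rep h(1) that by blast
  have f_D: "(f u, f v) \<in> parcs D" if "(u, v) \<in> K" for u v
  proof -
    have "rep u = rep v" "u \<in> ?V" using rep_step that K_VH by auto
    then show ?thesis using h(2)[OF rep(1), of u] that unfolding f_def preserves_def by auto
  qed
  have f_S: "(f u, f v) \<in> parcs G" if "(u, v) \<in> ?S" for u v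
    using that f_D D_sub symD[OF symG] by blast
  have walk_in_copy: "\<exists>y. q = e c y \<and> (x, y) \<in> A ^^ l" if "(e c x, q) \<in> parcs G ^^ l" "c \<in> ?V" for c x q l
    using that(1)
  proof (induction l arbitrary: q)
    case (Suc l)
    then obtain y where y: "(e c y, q) \<in> parcs G" "(x, y) \<in> A ^^ l" by fastforce
    then show ?case using e_closed[OF that(2) y(1)] by auto
  qed simp
  have shorter: "\<exists>k \<le> l. (u, v) \<in> ?S ^^ k" if uv: "u \<in> ?V" "v \<in> ?V" and walk: "(f u, f v) \<in> parcs G ^^ l" for u v l
  proof -
    obtain y where y: "f v = e (rep u) y" "(h (rep u) u, y) \<in> A ^^ l"
      using walk_in_copy[OF walk[unfolded f_def] rep(1)[OF uv(1)]] unfolding f_def by blast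
    then have rep_eq: "rep u = rep v" and "y = h (rep u) v"
      using e_inj[OF rep(1)[OF uv(2)] rep(1)[OF uv(1)]] unfolding f_def by metis+
    show ?thesis
    proof (cases "l \<le> Suc (card ?S)")
      case True
      then show ?thesis
        using F(2)[OF h(1)[OF rep(1)[OF uv(1)]]] y(2) \<open>y = _\<close> uv unfolding reflects_def by blast
    next
      \<comment> \<open>Connected vertices of \<open>H\<close> are joined by a walk of length at
        most \<open>card ?S\<close>, so a walk this long cannot be a shortcut.\<close>
      case False
      obtain k where "k \<le> card ?S" "(u, v) \<in> ?S ^^ k"
        using rep_conn[OF uv rep_eq] rtrancl_finite_eq_relpow[OF \<open>finite ?S\<close>] by auto
      then show ?thesis using False by (intro exI[of _ k]) auto
    qed
  qed
  have "inj_on f ?V"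
  proof (rule inj_onI)
    fix u v assume "u \<in> ?V" "v \<in> ?V" "f u = f v"
    then show "u = v" using shorter[of u v 0] by simp
  qed
  moreover have "f ` ?V \<subseteq> pverts G" using f_verts by blast
  moreover have "(u, v) \<in> parcs H \<longleftrightarrow> (f u, f v) \<in> parcs D" if uv: "u \<in> ?V" "v \<in> ?V" for u v
  proof
    show "(u, v) \<in> parcs H \<Longrightarrow> (f u, f v) \<in> parcs D" using f_D by (simp add: K_def)
    assume D': "(f u, f v) \<in> parcs D"
    then have arc: "(f u, f v) \<in> parcs G" using D_sub by blast
    then obtain k where k: "k \<le> 1" "(u, v) \<in> ?S ^^ k" using shorter[OF uv, of 1] by auto
    have "f u \<noteq> f v" using G.pair_no_loops[OF arc] by simp
    then have "k \<noteq> 0" using k(2) by (intro notI) simp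
    then have "k = 1" using k(1) by simp
    then have "(u, v) \<in> ?S" using k(2) by simp
    \<comment> \<open>The reverse arc in \<open>H\<close> would be mapped into \<open>D\<close>,
      which already contains the opposite one.\<close>
    moreover have "(v, u) \<notin> K" using f_D D_iff[OF arc] D' by blast
    ultimately show "(u, v) \<in> parcs H" by (simp add: K_def)
  qed
  moreover have "graph_dist H u v = graph_dist G (f u) (f v)" if uv: "u \<in> ?V" "v \<in> ?V" for u v
  proof -
    have "parcs G \<union> (parcs G)\<inverse> = parcs G" using symG by (simp add: sym_conv_converse_eq)
    then have dG: "graph_dist G (f u) (f v) = (INF l \<in> {l. (f u, f v) \<in> parcs G ^^ l}. enat l)"
      using graph_dist_relpow[OF G.pair_wf_digraph f_verts[OF uv(1)]] by simp
    have dH: "graph_dist H u v = (INF l \<in> {l. (u, v) \<in> ?S ^^ l}. enat l)"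
      using graph_dist_relpow[OF H.pair_wf_digraph uv(1)] by (simp add: K_def)
    show ?thesis
      unfolding dG dH
    proof (rule antisym)
      show "(INF l \<in> {l. (u, v) \<in> ?S ^^ l}. enat l) \<le> (INF l \<in> {l. (f u, f v) \<in> parcs G ^^ l}. enat l)"
        using shorter[OF uv] by (intro INF_mono) auto
      show "(INF l \<in> {l. (f u, f v) \<in> parcs G ^^ l}. enat l) \<le> (INF l \<in> {l. (u, v) \<in> ?S ^^ l}. enat l)"
        using relpow_map[of ?S f "parcs G", OF f_S] by (intro INF_mono) auto
    qed
  qed
  ultimately show "\<exists>f. isometric_copy f H D G" unfolding isometric_copy_def by blast
qed

text \<open>A single graph serves the whole family: the disjoint union of the hosts of all
  \<open>H\<close> in \<open>Hs\<close>, each repeated once per vertex of \<open>H\<close>, which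
  provides a copy for every component.\<close>

theorem corollary2p2:
  fixes Hs :: "'a pair_pre_digraph set"
  assumes "finite Hs"
    and "\<And>H. H \<in> Hs \<Longrightarrow> oriented_digraph H"
    and "\<And>H. H \<in> Hs \<Longrightarrow> acyclic_digraph H"
  shows "IR Hs < \<infinity>"
proof -
  have pair: "pair_digraph H" if "H \<in> Hs" for H
    using assms(2)[OF that] unfolding oriented_digraph_def by blast
  define S where "S H = parcs H \<union> (parcs H)\<inverse>" for H :: "'a pair_pre_digraph"
  have pat: "pattern (pverts H) (parcs H)" if "H \<in> Hs" for H
  proof -
    interpret pair_digraph H using pair[OF that] .
    show ?thesis using pair_finite_verts in_arcsD1 in_arcsD2 by unfold_locales auto
  qed
  have "\<exists>(A :: nat rel) F. pattern.host (pverts H) (parcs H) (Suc (card (S H))) A F" if "H \<in> Hs" for H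
  proof -
    interpret pair_digraph H using pair[OF that] .
    show ?thesis
      using pattern.host_exists[OF pat[OF that] acyclic_digraph_imp_acyclic[OF pair_wf_digraph assms(3)[OF that]]] .
  qed
  then obtain A :: "'a pair_pre_digraph \<Rightarrow> nat rel" and F where
    host: "\<And>H. H \<in> Hs \<Longrightarrow> pattern.host (pverts H) (parcs H) (Suc (card (S H))) (A H) (F H)"
    by metis
  have hostD: "finite (A H)" "sym (A H)" "irrefl (A H)" "finite (F H)" if "H \<in> Hs" for H
    using host[OF that] unfolding pattern.host_def[OF pat[OF that]] by blast+
  define I where "I = (SIGMA H:Hs. pverts H)"
  have "finite I"
    unfolding I_def using assms(1) pattern.finite_VH[OF pat] by blast
  then obtain idx :: "'a pair_pre_digraph \<times> 'a \<Rightarrow> nat" where idx: "inj_on idx I"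
    by (metis finite_imp_inj_to_nat_seg)
  \<comment> \<open>All copies are coded inside \<open>nat\<close>, the vertex type over which
    \<open>IR\<close> takes its infimum.\<close>
  define e where "e H c x = prod_encode (idx (H, c), x)" for H c x
  have e_eq: "H = H' \<and> c = c' \<and> x = y"
    if "e H c x = e H' c' y" "(H, c) \<in> I" "(H', c') \<in> I" for H H' c c' x y
    using that inj_onD[OF idx, of "(H, c)" "(H', c')"] by (simp add: e_def)
  \<comment> \<open>Isolated vertices of \<open>H\<close> may be sent outside the field of
    \<open>A H\<close>, so the images of the maps in \<open>F H\<close> are added as
    vertices.\<close>
  define G where "G = \<lparr>pverts = (\<Union>(H, c) \<in> I. e H c ` (Field (A H) \<union> (\<Union>f \<in> F H. f ` pverts H))),
    parcs = (\<Union>(H, c) \<in> I. (\<lambda>(x, y). (e H c x, e H c y)) ` A H)\<rparr>"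
  have arcs_I: "\<exists>H c x y. (H, c) \<in> I \<and> p = e H c x \<and> q = e H c y \<and> (x, y) \<in> A H" if "(p, q) \<in> parcs G" for p q
    using that unfolding G_def by auto
  have I_Hs: "H \<in> Hs" if "(H, c) \<in> I" for H c using that by (simp add: I_def)
  have G: "pair_graph G"
  proof
    show "finite (pverts G)" unfolding G_def
      using \<open>finite I\<close> I_Hs hostD(1,4) pattern.finite_VH[OF pat] by (auto simp: finite_Field)
    show "finite (parcs G)" unfolding G_def
      using \<open>finite I\<close> I_Hs hostD(1) by auto
    show "fst p \<in> pverts G" "snd p \<in> pverts G" if "p \<in> parcs G" for p
      using that unfolding G_def by (fastforce simp: Field_def)+
    show "fst p \<noteq> snd p" if p: "p \<in> parcs G" for p
    proof
      assume eq: "fst p = snd p"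
      obtain H c x y where "(H, c) \<in> I" "fst p = e H c x" "snd p = e H c y" "(x, y) \<in> A H"
        using arcs_I[of "fst p" "snd p"] p by auto
      then show False using eq e_eq hostD(3)[OF I_Hs] unfolding irrefl_def by metis
    qed
    show "symmetric G"
      unfolding symmetric_def sym_def
      using hostD(2)[OF I_Hs] by (fastforce simp: G_def sym_def)
  qed
  have "isometric_arrow G H" if H: "H \<in> Hs" for H
  proof (rule isometric_arrowI[where e = "e H" and A = "A H" and F = "F H"])
    have HI: "(H, c) \<in> I" if "c \<in> pverts H" for c using that H by (simp add: I_def)
    show "pair_digraph H" "pair_graph G" using pair[OF H] G by auto
    show "pattern.host (pverts H) (parcs H) (Suc (card (parcs H \<union> (parcs H)\<inverse>))) (A H) (F H)"
      using host[OF H] by (simp add: S_def)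
    show "c = c' \<and> x = y" if "c \<in> pverts H" "c' \<in> pverts H" "e H c x = e H c' y" for c c' x y
      using e_eq[OF that(3)] HI that by blast
    show "(e H c x, e H c y) \<in> parcs G" if "c \<in> pverts H" "(x, y) \<in> A H" for c x y
      using HI[OF that(1)] that(2) unfolding G_def by force
    show "\<exists>y. q = e H c y \<and> (x, y) \<in> A H" if c: "c \<in> pverts H" and arc: "(e H c x, q) \<in> parcs G" for c x q
    proof -
      obtain H' c' x' y where "(H', c') \<in> I" "e H c x = e H' c' x'" "q = e H' c' y" "(x', y) \<in> A H'"
        using arcs_I[OF arc] by blast
      then show ?thesis using e_eq HI[OF c] by metis
    qed
    show "e H c (f u) \<in> pverts G" if "c \<in> pverts H" "f \<in> F H" "u \<in> pverts H" for c f u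
      using HI[OF that(1)] that(2,3) unfolding G_def by force
  qed
  then have "IR Hs \<le> enat (card (pverts G))"
    unfolding IR_def using G by (intro INF_lower) simp
  then show ?thesis using le_less_trans enat_ord_code(4) by blast
qed

end
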